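(* Let $\{\psi_j\}_{j\ge0}$ be the univariate orthonormal polynomials with respect to a probability density $\rho$. For any integers $k\ge1$ and $p\ge0$, the $(p+1)\times(p+1)$ univariate stochastic Galerkin matrix $\mathbf U_{k,p}$ is built up from the first $p+1$ rows and columns of the operational matrix $\mathbf H_{p,k}$ of the basis $\{\psi_j\}$, i.e. $$\mathbf U_{k,p}=\mathbf H_{p,k}(1:p+1,\;1:p+1).$$
   Context: $\rho$ is a probability density on the real line for which the orthonormal polynomials exist: $\deg\psi_j=j$, $\psi_0=1$, and $\langle\psi_i\psi_j\rangle=\delta_{ij}$, where $\langle f\rangle=\int f(y)\rho(y)\,dy$. The stochastic Galerkin matrix $\mathbf U_{k,p}$ has entries $\mathbf U_{k,p}[i,j]=\langle\psi_k\psi_i\psi_j\rangle$ for $i,j=0,\dots,p$ (rows and columns indexed from $0$, so the entry with indices $(i,j)$ sits in the $(i+1)$-st row and $(j+1)$-st column). The polynomials satisfy a three-term recurrence $y\psi_j=\alpha_j\psi_{j+1}+\beta_j\psi_j+\gamma_j\psi_{j-1}$ ($\psi_{-1}=0$, $\alpha_j\ne0$). The operational matrix $\mathbf H_{p,k}$ is the $(p+1)\times(p+k+1)$ matrix, with rows and columns indexed from $1$, such that $\psi_k(y)[\psi_0(y),\dots,\psi_p(y)]^T=\mathbf H_{p,k}[\psi_0(y),\dots,\psi_{p+k}(y)]^T$; its entries are given recursively by $\mathbf H_{p,k}[1,k+1]=1$; $\mathbf H_{p,k}[i,j]=0$ if $j\le|k+1-i|$ or $j\ge k+1+i$; otherwise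 $\mathbf H_{p,k}[i,j]=\frac1{\alpha_{i-2}}\bigl(\alpha_{j-2}\mathbf H_{p,k}[i-1,j-1]+(\beta_{j-1}-\beta_{i-2})\mathbf H_{p,k}[i-1,j]+\gamma_j\mathbf H_{p,k}[i-1,j+1]-\gamma_{i-2}\mathbf H_{p,k}[i-2,j]\bigr)$, with entries having a zero or negative index or $j>p+k+1$ set to $0$. $A(1:r,1:r)$ denotes the leading $r\times r$ submatrix of $A$. *)

theory Defs
  imports
    "HOL-Analysis.Bochner_Integration"
    "HOL-Analysis.Lebesgue_Measure"
    "HOL-Computational_Algebra.Polynomial"
    "Jordan_Normal_Form.DL_Submatrix"
begin

(* The moments are required to be finite so that every bracket below is a genuine integral
   (integral takes the value 0 on non-integrable functions); orthonormality with degree n at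
   index n forces this anyway. *)
definition prob_density_moments :: "(real \<Rightarrow> real) \<Rightarrow> bool" where
  "prob_density_moments \<rho> \<longleftrightarrow>
     \<rho> \<in> borel_measurable borel \<and> (\<forall>y. 0 \<le> \<rho> y) \<and>
     integrable lborel \<rho> \<and> (LINT y|lborel. \<rho> y) = 1 \<and>
     (\<forall>n::nat. integrable lborel (\<lambda>y. y ^ n * \<rho> y))"

definition mean :: "(real \<Rightarrow> real) \<Rightarrow> (real \<Rightarrow> real) \<Rightarrow> real" where
  "mean \<rho> f = (LINT y|lborel. f y * \<rho> y)"

definition orthonormal_polys :: "(real \<Rightarrow> real) \<Rightarrow> (nat \<Rightarrow> real poly) \<Rightarrow> bool" where
  "orthonormal_polys \<rho> \<psi> \<longleftrightarrow>
     (\<forall>j. degree (\<psi> j) = j) \<and> \<psi> 0 = 1 \<and>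
     (\<forall>i j. mean \<rho> (\<lambda>y. poly (\<psi> i) y * poly (\<psi> j) y) = (if i = j then 1 else 0))"

definition three_term_recurrence ::
  "(nat \<Rightarrow> real poly) \<Rightarrow> (nat \<Rightarrow> real) \<Rightarrow> (nat \<Rightarrow> real) \<Rightarrow> (nat \<Rightarrow> real) \<Rightarrow> bool" where
  "three_term_recurrence \<psi> \<alpha> \<beta> \<gamma> \<longleftrightarrow>
     (\<forall>j. \<alpha> j \<noteq> 0) \<and>
     (\<forall>j y. y * poly (\<psi> j) y =
        \<alpha> j * poly (\<psi> (j + 1)) y + \<beta> j * poly (\<psi> j) y
        + \<gamma> j * (if j = 0 then 0 else poly (\<psi> (j - 1)) y))"

definition galerkin_matrix :: "(real \<Rightarrow> real) \<Rightarrow> (nat \<Rightarrow> real poly) \<Rightarrow> nat \<Rightarrow> nat \<Rightarrow> real mat" where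
  "galerkin_matrix \<rho> \<psi> k p = mat (p + 1) (p + 1)
     (\<lambda>(i, j). mean \<rho> (\<lambda>y. poly (\<psi> k) y * poly (\<psi> i) y * poly (\<psi> j) y))"

(* Indices are 1-based. In the last branch i >= 2 and j >= 1, so the only truncated subtraction is
   j - 2 at j = 1; there the factor with column index j - 1 = 0 vanishes. *)
function op_entry ::
  "(nat \<Rightarrow> real) \<Rightarrow> (nat \<Rightarrow> real) \<Rightarrow> (nat \<Rightarrow> real) \<Rightarrow> nat \<Rightarrow> nat \<Rightarrow> nat \<Rightarrow> nat \<Rightarrow> real" where
  "op_entry \<alpha> \<beta> \<gamma> p k i j =
     (if i = 0 \<or> j = 0 \<or> j > p + k + 1 then 0
      else if i = 1 \<and> j = k + 1 then 1
      else if int j \<le> \<bar>int k + 1 - int i\<bar> \<or> j \<ge> k + 1 + i then 0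
      else 1 / \<alpha> (i - 2) *
        (\<alpha> (j - 2) * op_entry \<alpha> \<beta> \<gamma> p k (i - 1) (j - 1)
         + (\<beta> (j - 1) - \<beta> (i - 2)) * op_entry \<alpha> \<beta> \<gamma> p k (i - 1) j
         + \<gamma> j * op_entry \<alpha> \<beta> \<gamma> p k (i - 1) (j + 1)
         - \<gamma> (i - 2) * op_entry \<alpha> \<beta> \<gamma> p k (i - 2) j))"
  by pat_completeness auto
termination
  by (relation "Wellfounded.measure (\<lambda>(\<alpha>, \<beta>, \<gamma>, p, k, i, j). i)") auto

declare op_entry.simps [simp del]

(* Matrices of this library are indexed from 0, hence the shift. *)
definition operational_matrix ::
  "(nat \<Rightarrow> real) \<Rightarrow> (nat \<Rightarrow> real) \<Rightarrow> (nat \<Rightarrow> real) \<Rightarrow> nat \<Rightarrow> nat \<Rightarrow> real mat" where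
  "operational_matrix \<alpha> \<beta> \<gamma> p k =
     mat (p + 1) (p + k + 1) (\<lambda>(i, j). op_entry \<alpha> \<beta> \<gamma> p k (i + 1) (j + 1))"

definition represents_multiplication ::
  "(nat \<Rightarrow> real poly) \<Rightarrow> nat \<Rightarrow> nat \<Rightarrow> real mat \<Rightarrow> bool" where
  "represents_multiplication \<psi> p k H \<longleftrightarrow>
     H \<in> carrier_mat (p + 1) (p + k + 1) \<and>
     (\<forall>y. poly (\<psi> k) y \<cdot>\<^sub>v vec (p + 1) (\<lambda>i. poly (\<psi> i) y)
        = H *\<^sub>v vec (p + k + 1) (\<lambda>j. poly (\<psi> j) y))"

context
  fixes \<rho> \<psi>
  assumes dens: "prob_density_moments \<rho>" and orth: "orthonormal_polys \<rho> \<psi>"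
begin

private definition L :: "real poly \<Rightarrow> real" where "L q = mean \<rho> (poly q)"

private lemma poly_ext: "(\<And>y. poly p y = poly q y) \<Longrightarrow> p = q" for p q :: "real poly"
  using poly_eq_poly_eq_iff by blast

private lemma int: "integrable lborel (\<lambda>y. poly q y * \<rho> y)"
proof -
  have "integrable lborel (\<lambda>y. \<Sum>i\<le>degree q. coeff q i * (y ^ i * \<rho> y))"
    using dens unfolding prob_density_moments_def by (intro Bochner_Integration.integrable_sum) auto
  then show ?thesis by (simp add: poly_altdef sum_distrib_right mult.assoc)
qed

private lemma L_add: "L (p + q) = L p + L q"
  unfolding L_def mean_def using int[of p] int[of q] by (simp add: distrib_right)

private lemma L_smult: "L (Polynomial.smult c q) = c * L q"
  unfolding L_def mean_def by (simp add: mult.assoc)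

private lemma L_0: "L 0 = 0"
  unfolding L_def mean_def by simp

private lemma L_sum: "L (\<Sum>i\<in>A. f i) = (\<Sum>i\<in>A. L (f i))"
  by (induction A rule: infinite_finite_induct) (auto simp: L_0 L_add)

private lemma deg: "degree (\<psi> j) = j" and L_orth: "L (\<psi> i * \<psi> j) = (if i = j then 1 else 0)"
  using orth unfolding orthonormal_polys_def L_def mean_def by auto

private lemma L_comb: "L ((\<Sum>i\<le>n. Polynomial.smult (a i) (\<psi> i)) * \<psi> j) = (if j \<le> n then a j else 0)"
proof -
  have "L ((\<Sum>i\<le>n. Polynomial.smult (a i) (\<psi> i)) * \<psi> j) = (\<Sum>i\<le>n. a i * (if i = j then 1 else 0))"
    by (simp add: sum_distrib_right L_sum L_smult L_orth)
  also have "\<dots> = (if j \<le> n then a j else 0)"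
    by (simp add: if_distrib cong: if_cong)
  finally show ?thesis .
qed

private lemma expand_ex: "degree q \<le> n \<Longrightarrow> \<exists>a. q = (\<Sum>i\<le>n. Polynomial.smult (a i) (\<psi> i))"
proof (induction n arbitrary: q)
  case 0
  then obtain c where "q = [:c:]" by (metis degree_eq_zeroE le_zero_eq)
  moreover have "\<psi> 0 = 1" using orth by (simp add: orthonormal_polys_def)
  ultimately show ?case by (intro exI[of _ "\<lambda>_. c"]) simp
next
  case (Suc n)
  define c where "c = coeff q (Suc n) / coeff (\<psi> (Suc n)) (Suc n)"
  have nz: "coeff (\<psi> (Suc n)) (Suc n) \<noteq> 0"
    using deg[of "Suc n"] by (metis degree_0 leading_coeff_0_iff nat.distinct(1))
  have "degree (q - Polynomial.smult c (\<psi> (Suc n))) \<le> n"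
  proof (rule degree_le, intro allI impI)
    fix i assume "n < i"
    then consider "i = Suc n" | "i > Suc n" by linarith
    then show "coeff (q - Polynomial.smult c (\<psi> (Suc n))) i = 0"
    proof cases
      case 1 then show ?thesis using nz by (simp add: c_def)
    next
      case 2 then show ?thesis using Suc.prems deg[of "Suc n"] by (simp add: coeff_eq_0)
    qed
  qed
  from Suc.IH[OF this] obtain a where "q - Polynomial.smult c (\<psi> (Suc n)) = (\<Sum>i\<le>n. Polynomial.smult (a i) (\<psi> i))" ..
  then have "q = (\<Sum>i\<le>Suc n. Polynomial.smult ((a(Suc n := c)) i) (\<psi> i))"
    by (simp add: algebra_simps)
  then show ?case by blast
qed

private lemma expand:
  assumes "degree q \<le> n"
  shows "q = (\<Sum>i\<le>n. Polynomial.smult (L (q * \<psi> i)) (\<psi> i))"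
proof -
  obtain a where a: "q = (\<Sum>i\<le>n. Polynomial.smult (a i) (\<psi> i))" using expand_ex[OF assms] ..
  have "L (q * \<psi> i) = a i" if "i \<le> n" for i
    unfolding a L_comb using that by simp
  then show ?thesis by (subst a) simp
qed

private lemma L_high: "degree q < j \<Longrightarrow> L (q * \<psi> j) = 0"
  using expand_ex[of q "degree q"] L_comb[where n = "degree q" and j = j] by (metis linorder_not_less order.refl)

private definition c :: "nat \<Rightarrow> nat \<Rightarrow> nat \<Rightarrow> real" where "c k i j = L (\<psi> k * \<psi> i * \<psi> j)"

private lemma c_zero: "j > k + i \<or> i > k + j \<or> k > i + j \<Longrightarrow> c k i j = 0"
proof -
  have *: "L (\<psi> a * \<psi> b * \<psi> d) = 0" if "d > a + b" for a b d
    using that degree_mult_le[of "\<psi> a" "\<psi> b"] by (intro L_high) (simp add: deg)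
  show "j > k + i \<or> i > k + j \<or> k > i + j \<Longrightarrow> c k i j = 0"
    using *[of k i j] *[of k j i] *[of i j k] by (auto simp: c_def mult_ac)
qed

private lemma galerkin_c:
  "galerkin_matrix \<rho> \<psi> k p = mat (p + 1) (p + 1) (\<lambda>(i, j). c k i j)"
  unfolding galerkin_matrix_def c_def L_def by (simp add: mean_def)

private lemma rep_iff_c:
  "represents_multiplication \<psi> p k H \<longleftrightarrow> H = mat (p + 1) (p + k + 1) (\<lambda>(i, j). c k i j)"
  (is "_ \<longleftrightarrow> H = ?M")
proof
  have row: "(H *\<^sub>v vec (p + k + 1) (\<lambda>j. poly (\<psi> j) y)) $ i
      = poly (\<Sum>j\<le>p+k. Polynomial.smult (H $$ (i,j)) (\<psi> j)) y"
    if "H \<in> carrier_mat (p + 1) (p + k + 1)" "i \<le> p" for i y and H :: "real mat"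
    using that by (auto simp: scalar_prod_def poly_sum atLeast0LessThan lessThan_Suc_atMost)
  show "H = ?M" if "represents_multiplication \<psi> p k H"
  proof (rule eq_matI)
    from that have H: "H \<in> carrier_mat (p + 1) (p + k + 1)" 
      and E: "\<And>y. poly (\<psi> k) y \<cdot>\<^sub>v vec (p + 1) (\<lambda>i. poly (\<psi> i) y)
        = H *\<^sub>v vec (p + k + 1) (\<lambda>j. poly (\<psi> j) y)" 
      by (auto simp: represents_multiplication_def)
    show "dim_row H = dim_row ?M" "dim_col H = dim_col ?M" using H by auto
    fix i j assume "i < dim_row ?M" "j < dim_col ?M"
    then have ij: "i \<le> p" "j \<le> p + k" by auto
    have "\<psi> k * \<psi> i = (\<Sum>j\<le>p+k. Polynomial.smult (H $$ (i,j)) (\<psi> j))"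
    proof (rule poly_ext)
      fix y show "poly (\<psi> k * \<psi> i) y = poly (\<Sum>j\<le>p+k. Polynomial.smult (H $$ (i,j)) (\<psi> j)) y"
        using arg_cong[OF E, of "\<lambda>v. v $ i"] row[OF H ij(1)] ij by simp
    qed
    then have "c k i j = H $$ (i,j)" unfolding c_def using L_comb ij by simp
    then show "H $$ (i,j) = ?M $$ (i,j)" using ij by simp
  qed
  show "represents_multiplication \<psi> p k H" if "H = ?M"
  proof -
    have "?M \<in> carrier_mat (p + 1) (p + k + 1)" by simp
    note r = row[OF this]
    have "poly (\<psi> k) y \<cdot>\<^sub>v vec (p + 1) (\<lambda>i. poly (\<psi> i) y)
        = ?M *\<^sub>v vec (p + k + 1) (\<lambda>j. poly (\<psi> j) y)" for y
    proof (rule eq_vecI)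
      fix i assume "i < dim_vec (?M *\<^sub>v vec (p + k + 1) (\<lambda>j. poly (\<psi> j) y))"
      then have i: "i \<le> p" by simp
      have "degree (\<psi> k * \<psi> i) \<le> p + k"
        using degree_mult_le[of "\<psi> k" "\<psi> i"] i by (simp add: deg)
      then have "\<psi> k * \<psi> i = (\<Sum>j\<le>p+k. Polynomial.smult (?M $$ (i,j)) (\<psi> j))"
        using i expand[of "\<psi> k * \<psi> i" "p + k"] by (simp add: c_def)
      then have "poly (\<psi> k * \<psi> i) y = poly (\<Sum>j\<le>p+k. Polynomial.smult (?M $$ (i,j)) (\<psi> j)) y" by simp
      then show "(poly (\<psi> k) y \<cdot>\<^sub>v vec (p + 1) (\<lambda>i. poly (\<psi> i) y)) $ i
        = (?M *\<^sub>v vec (p + k + 1) (\<lambda>j. poly (\<psi> j) y)) $ i"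
        unfolding r[OF i] using i by simp
    qed simp
    then show ?thesis using that by (simp add: represents_multiplication_def)
  qed
qed

context
  fixes \<alpha> \<beta> \<gamma>
  assumes rec: "three_term_recurrence \<psi> \<alpha> \<beta> \<gamma>"
begin

private lemma rec_poly:
  "[:0, 1:] * \<psi> j = Polynomial.smult (\<alpha> j) (\<psi> (j + 1)) + Polynomial.smult (\<beta> j) (\<psi> j)
     + Polynomial.smult (\<gamma> j) (if j = 0 then 0 else \<psi> (j - 1))"
  by (rule poly_ext) (use rec in \<open>auto simp: three_term_recurrence_def\<close>)

private lemma shift:
  "L (q * ([:0, 1:] * \<psi> j)) = \<alpha> j * L (q * \<psi> (j + 1)) + \<beta> j * L (q * \<psi> j)
     + \<gamma> j * (if j = 0 then 0 else L (q * \<psi> (j - 1)))"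
  unfolding rec_poly by (simp add: distrib_left L_add L_smult L_0)

private lemma gamma_alpha: "\<gamma> (j + 1) = \<alpha> j"
proof -
  have "L (\<psi> j * ([:0, 1:] * \<psi> (j + 1))) = \<gamma> (j + 1)"
    unfolding shift by (simp add: L_orth)
  moreover have "L (\<psi> (j + 1) * ([:0, 1:] * \<psi> j)) = \<alpha> j"
    unfolding shift by (simp add: L_orth)
  ultimately show ?thesis by (simp only: mult_ac)
qed

private lemma c_rec:
  "\<alpha> i * c k (i + 1) j + \<beta> i * c k i j + \<gamma> i * (if i = 0 then 0 else c k (i - 1) j)
   = \<alpha> j * c k i (j + 1) + \<beta> j * c k i j + \<gamma> j * (if j = 0 then 0 else c k i (j - 1))"
proof -
  have "L ((\<psi> k * \<psi> j) * ([:0, 1:] * \<psi> i)) = L ((\<psi> k * \<psi> i) * ([:0, 1:] * \<psi> j))"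
    by (simp only: mult_ac)
  then show ?thesis unfolding shift c_def by (simp only: mult_ac)
qed

private lemma entry_c:
  assumes "i \<le> p + 1"
  shows "op_entry \<alpha> \<beta> \<gamma> p k i j = (if i = 0 \<or> j = 0 then 0 else c k (i - 1) (j - 1))"
  using assms
proof (induction i arbitrary: j rule: less_induct)
  case (less i)
  have a: "\<alpha> n \<noteq> 0" for n using rec by (simp add: three_term_recurrence_def)
  consider "i = 0 \<or> j = 0" | "i \<noteq> 0" "j > p + k + 1" | "i = 1" "j = k + 1" 
    | "i \<noteq> 0" "j \<noteq> 0" "j \<le> p + k + 1" "\<not> (i = 1 \<and> j = k + 1)" 
      "int j \<le> \<bar>int k + 1 - int i\<bar> \<or> j \<ge> k + 1 + i" 
    | "i \<noteq> 0" "j \<noteq> 0" "j \<le> p + k + 1" "\<not> (i = 1 \<and> j = k + 1)"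
      "\<not> (int j \<le> \<bar>int k + 1 - int i\<bar> \<or> j \<ge> k + 1 + i)"
    by linarith
  then show ?case
  proof cases
    case 1 then show ?thesis by (subst op_entry.simps) auto
  next
    case 2 
    then have "c k (i - 1) (j - 1) = 0" using less.prems by (intro c_zero) auto
    then show ?thesis using 2 by (subst op_entry.simps) auto
  next
    case 3
    have "\<psi> 0 = 1" using orth by (simp add: orthonormal_polys_def)
    then have "c k 0 k = 1" by (simp add: c_def L_orth)
    moreover have "op_entry \<alpha> \<beta> \<gamma> p k i j = (if j > p + k + 1 then 0 else 1)" 
      using 3 by (subst op_entry.simps) auto
    ultimately show ?thesis using 3 by simp
  next
    case 4
    then have "c k (i - 1) (j - 1) = 0" by (intro c_zero) linarith
    then show ?thesis using 4 by (subst op_entry.simps) auto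
  next
    case 5
    then have "i \<noteq> 1" by auto
    with 5 obtain m where m: "i = m + 2" by (metis One_nat_def Suc_1 add.commute add_2_eq_Suc nat.exhaust)
    obtain n where n: "j = n + 1" using 5 by (metis Suc_eq_plus1 nat.exhaust)
    have IH: "op_entry \<alpha> \<beta> \<gamma> p k (m + 1) l = (if l = 0 then 0 else c k m (l - 1))"
      "op_entry \<alpha> \<beta> \<gamma> p k m l = (if m = 0 \<or> l = 0 then 0 else c k (m - 1) (l - 1))" for l
      using less.IH[of "m + 1" l] less.IH[of m l] less.prems m by auto
    have "op_entry \<alpha> \<beta> \<gamma> p k i j = 1 / \<alpha> m *
        (\<alpha> (j - 2) * op_entry \<alpha> \<beta> \<gamma> p k (m + 1) n
         + (\<beta> n - \<beta> m) * op_entry \<alpha> \<beta> \<gamma> p k (m + 1) (n + 1)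
         + \<gamma> (n + 1) * op_entry \<alpha> \<beta> \<gamma> p k (m + 1) (n + 2)
         - \<gamma> m * op_entry \<alpha> \<beta> \<gamma> p k m (n + 1))"
      using 5 unfolding m n by (subst op_entry.simps) auto
    also have "\<dots> = 1 / \<alpha> m *
        ((if n = 0 then 0 else \<gamma> n * c k m (n - 1)) + (\<beta> n - \<beta> m) * c k m n
         + \<alpha> n * c k m (n + 1) - \<gamma> m * (if m = 0 then 0 else c k (m - 1) n))"
      unfolding IH using gamma_alpha[of n] gamma_alpha[of "n - 1"] n by auto
    also have "(if n = 0 then 0 else \<gamma> n * c k m (n - 1)) + (\<beta> n - \<beta> m) * c k m n
         + \<alpha> n * c k m (n + 1) - \<gamma> m * (if m = 0 then 0 else c k (m - 1) n) = \<alpha> m * c k (m + 1) n"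
      using c_rec[of m k n] by (auto simp: left_diff_distrib split: if_splits)
    also have "1 / \<alpha> m * (\<alpha> m * c k (m + 1) n) = c k (m + 1) n" using a by simp
    finally show ?thesis by (simp add: m n)
  qed
qed

private lemma operational_c:
  "operational_matrix \<alpha> \<beta> \<gamma> p k = mat (p + 1) (p + k + 1) (\<lambda>(i, j). c k i j)"
  unfolding operational_matrix_def by (rule eq_matI) (auto simp: entry_c)

(* The recursively computed matrix is the one determined by the defining identity of the
   operational matrix. *)
lemma represents_multiplication_iff:
  "represents_multiplication \<psi> p k H \<longleftrightarrow> H = operational_matrix \<alpha> \<beta> \<gamma> p k"
  unfolding rep_iff_c operational_c ..

end

end

end

(* Multiplication by psi_k sends psi_i to a combination of psi_0, ..., psi_{p+k} whose coefficients
   are the i-th row of H. Pairing with psi_j, j <= p + k, reads off the entry H[i,j] by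
   orthonormality, and the same pairing is the Galerkin entry. *)
theory Submission
  imports Defs
begin

text \<open>The integral is additive only over integrable functions, so this is what lets
  \<open>mean\<close> pass through finite sums of polynomials. It follows from the finite
  moments.\<close>

lemma integrable_poly_density:
  assumes "prob_density_moments \<rho>"
  shows "integrable lborel (\<lambda>y. poly q y * \<rho> y)"
proof -
  have "integrable lborel (\<lambda>y. \<Sum>i\<le>degree q. coeff q i * (y ^ i * \<rho> y))"
    using assms unfolding prob_density_moments_def
    by (intro Bochner_Integration.integrable_sum) auto
  then show ?thesis
    by (simp add: poly_altdef sum_distrib_right mult.assoc)
qed

lemma mean_sum_poly:
  assumes "prob_density_moments \<rho>"
  shows "mean \<rho> (\<lambda>y. \<Sum>l\<in>A. a l * poly (q l) y) = (\<Sum>l\<in>A. a l * mean \<rho> (poly (q l)))"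
  using integrable_poly_density[OF assms]
  by (simp add: mean_def sum_distrib_right mult.assoc Bochner_Integration.integral_sum)

text \<open>Orthonormality leaves only the term \<open>l = j\<close>. A pointwise expansion of a
  plain function \<open>f\<close> suffices, so rows of a matrix-vector identity can be fed in
  directly.\<close>

lemma mean_mult_eq_coeff:
  assumes "prob_density_moments \<rho>" and "orthonormal_polys \<rho> \<psi>"
    and "finite A" and "j \<in> A"
    and expansion: "\<And>y. f y = (\<Sum>l\<in>A. a l * poly (\<psi> l) y)"
  shows "mean \<rho> (\<lambda>y. f y * poly (\<psi> j) y) = a j"
proof -
  have "mean \<rho> (\<lambda>y. f y * poly (\<psi> j) y) = mean \<rho> (\<lambda>y. \<Sum>l\<in>A. a l * poly (\<psi> l * \<psi> j) y)"
    by (simp add: expansion sum_distrib_right mult.assoc)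
  also have "\<dots> = (\<Sum>l\<in>A. a l * mean \<rho> (poly (\<psi> l * \<psi> j)))"
    by (rule mean_sum_poly[OF assms(1)])
  also have "\<dots> = (\<Sum>l\<in>A. if l = j then a l else 0)"
  proof (rule sum.cong)
    fix l
    \<comment> \<open>\<open>orthonormal_polys\<close> is stated for the pointwise product of the
      two functions.\<close>
    have "poly (\<psi> l * \<psi> j) = (\<lambda>y. poly (\<psi> l) y * poly (\<psi> j) y)"
      by auto
    then show "a l * mean \<rho> (poly (\<psi> l * \<psi> j)) = (if l = j then a l else 0)"
      using assms(2) by (simp add: orthonormal_polys_def)
  qed simp
  also have "\<dots> = a j"
    using assms(3,4) by simp
  finally show ?thesis .
qed

text \<open>Row \<open>i\<close> of \<open>H\<close> lists the coefficients of \<psi> k * \<psi> i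
  in the basis, and pairing with \<psi> j extracts the one in column \<open>j\<close>.\<close>

lemma represents_multiplication_entry:
  assumes "prob_density_moments \<rho>" and "orthonormal_polys \<rho> \<psi>"
    and "represents_multiplication \<psi> p k H"
    and "i \<le> p" and "j \<le> p + k"
  shows "mean \<rho> (\<lambda>y. poly (\<psi> k) y * poly (\<psi> i) y * poly (\<psi> j) y) = H $$ (i, j)"
proof (rule mean_mult_eq_coeff[OF assms(1,2), where A = "{..<p + k + 1}"])
  fix y
  have H: "H \<in> carrier_mat (p + 1) (p + k + 1)"
    and eq: "poly (\<psi> k) y \<cdot>\<^sub>v vec (p + 1) (\<lambda>i. poly (\<psi> i) y)
      = H *\<^sub>v vec (p + k + 1) (\<lambda>j. poly (\<psi> j) y)"
    using assms(3) by (auto simp: represents_multiplication_def)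
  show "poly (\<psi> k) y * poly (\<psi> i) y = (\<Sum>l<p + k + 1. H $$ (i, l) * poly (\<psi> l) y)"
    using arg_cong[OF eq, of "\<lambda>v. v $ i"] H assms(4)
    by (auto simp: scalar_prod_def atLeast0LessThan)
qed (use assms(5) in auto)

text \<open>\<open>pick\<close> enumerates a set in increasing order from 0, and \<open>i\<close>
  has exactly \<open>i\<close> predecessors in an initial segment.\<close>

lemma pick_atMost:
  assumes "i \<le> n"
  shows "pick {..n} i = i"
proof -
  have "{a \<in> {..n}. a < i} = {..<i}"
    using assms by auto
  then show ?thesis
    using pick_card_in_set[of i "{..n}"] assms by simp
qed

lemma submatrix_atMost:
  assumes "m < dim_row A" and "n < dim_col A"
  shows "submatrix A {..m} {..n} = mat (m + 1) (n + 1) (\<lambda>(i, j). A $$ (i, j))"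
proof -
  \<comment> \<open>The cardinality of such a set is a dimension of \<open>submatrix\<close>; the
    strict bound prevents clipping at the matrix border.\<close>
  have "{i. i < d \<and> i \<in> {..r}} = {..r}" if "r < d" for r d :: nat
    using that by auto
  then show ?thesis
    unfolding submatrix_def using assms by (intro eq_matI) (auto simp: pick_atMost)
qed

theorem lemma6p1:
  fixes \<rho> :: "real \<Rightarrow> real" and \<psi> :: "nat \<Rightarrow> real poly"
    and \<alpha> \<beta> \<gamma> :: "nat \<Rightarrow> real" and k p :: nat
  assumes "prob_density_moments \<rho>"
    and "orthonormal_polys \<rho> \<psi>"
    and "three_term_recurrence \<psi> \<alpha> \<beta> \<gamma>"
    and "k \<ge> 1"
  shows "galerkin_matrix \<rho> \<psi> k p = submatrix (operational_matrix \<alpha> \<beta> \<gamma> p k) {..p} {..p}"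
proof -
  let ?H = "operational_matrix \<alpha> \<beta> \<gamma> p k"
  \<comment> \<open>The entry recursion enters only here; afterwards \<open>?H\<close> is used
    through its defining identity and its dimensions.\<close>
  have rep: "represents_multiplication \<psi> p k ?H"
    using represents_multiplication_iff[OF assms(1-3)] by simp
  have "galerkin_matrix \<rho> \<psi> k p = mat (p + 1) (p + 1) (\<lambda>(i, j). ?H $$ (i, j))"
    unfolding galerkin_matrix_def
    by (rule eq_matI) (auto simp: represents_multiplication_entry[OF assms(1,2) rep])
  also have "\<dots> = submatrix ?H {..p} {..p}"
    by (rule submatrix_atMost[symmetric]) (simp_all add: operational_matrix_def)
  finally show ?thesis .
qed

end
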